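(* Let $k$ be a field of characteristic zero, let $F\in k[x_1,\ldots,x_n]$ be a homogeneous polynomial of degree $D\ge 1$, $F\neq 0$, and let $A=Q/\mathrm{Ann}_Q F=\bigoplus_{d=0}^D A_d$ with $Q=k[X_1,\ldots,X_n]$ acting on $k[x_1,\ldots,x_n]$ by $X_i=\partial/\partial x_i$. For each $d=1,\ldots,[D/2]$ fix an arbitrary $k$-linear basis $\mathbf{B}_d$ of $A_d$. Then an element $L=a_1X_1+\cdots+a_nX_n\in A_1$ (with $a_1,\ldots,a_n\in k$) is a strong Lefschetz element of $A$ if and only if $F(a_1,\ldots,a_n)\neq 0$ and $$(\mathrm{Hess}^{(d)}_{\mathbf{B}_d}F)(a_1,\ldots,a_n)\neq 0\quad\text{for all } d=1,\ldots,[D/2].$$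
   Context: $R=k[x_1,\ldots,x_n]$ is regarded as a module over $Q=k[X_1,\ldots,X_n]$ by letting $X_i$ act as $\partial/\partial x_i$. For $F\in R$, $\mathrm{Ann}_Q F=\{a(X_1,\ldots,X_n)\in Q \mid a(\partial_1,\ldots,\partial_n)F=0\}$. If $F$ is nonzero and homogeneous of degree $D$, this ideal is homogeneous and $A=Q/\mathrm{Ann}_Q F=\bigoplus_{d=0}^D A_d$ is a graded Artinian Gorenstein algebra (standard grading) of socle degree $D$. An element $L\in A_1$ is a strong Lefschetz element of $A$ (in the narrow sense) if the multiplication map $\times L^{D-2i}:A_i\to A_{D-i}$ is bijective for all $i=0,\ldots,[D/2]$, where $[\cdot]$ is the integer part. Given a $k$-linear basis $\mathbf{B}_d=\{\alpha^{(d)}_i\}_i$ of $A_d$ (represented by homogeneous polynomials of degree $d$ in $Q$), the $d$-th Hessian of $F$ with respect to $\mathbf{B}_d$ is the polynomial $$\mathrm{Hess}^{(d)}_{\mathbf{B}_d}F=\det\Big(\big(\alpha^{(d)}_i(X)\,\alpha^{(d)}_j(X)\,F(x)\big)_{i,j=1}^{\dim_k A_d}\Big)\in k[x_1,\ldots,x_n].$$ *)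

theory Defs
  imports
    "HOL-Library.Poly_Mapping"
    "HOL-Algebra.QuotRing"
    "HOL-Algebra.Embedded_Algebras"
    "HOL-Algebra.Algebraic_Closure_Type"
    "Jordan_Normal_Form.Determinant"
begin

section \<open>Polynomials in finitely many variables\<close>

text \<open>
  A polynomial is a finitely supported function from exponent vectors to coefficients; the ring
  operations are those of \<^theory>\<open>HOL-Library.Poly_Mapping\<close>. The variables are indexed by a finite
  type \<open>'n\<close>. Both \<open>R = k[x\<^sub>1,\<dots>,x\<^sub>n]\<close> and \<open>Q = k[X\<^sub>1,\<dots>,X\<^sub>n]\<close> are modelled by this type.
\<close>

type_synonym ('n, 'k) mpoly = "('n \<Rightarrow>\<^sub>0 nat) \<Rightarrow>\<^sub>0 'k"

definition Const :: "'k \<Rightarrow> ('n, 'k::zero) mpoly" where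
  "Const c = Poly_Mapping.single 0 c"

definition Var :: "'n \<Rightarrow> ('n, 'k::zero_neq_one) mpoly" where
  "Var i = Poly_Mapping.single (Poly_Mapping.single i 1) 1"

definition mpoly_eval :: "('n::finite \<Rightarrow> 'k) \<Rightarrow> ('n, 'k::comm_semiring_1) mpoly \<Rightarrow> 'k" where
  "mpoly_eval a F = (\<Sum>m\<in>Poly_Mapping.keys F.
     Poly_Mapping.lookup F m * (\<Prod>i\<in>UNIV. a i ^ Poly_Mapping.lookup m i))"

definition homogeneous :: "nat \<Rightarrow> ('n::finite, 'k::zero) mpoly \<Rightarrow> bool" where
  "homogeneous d F \<longleftrightarrow>
     (\<forall>m\<in>Poly_Mapping.keys F. (\<Sum>i\<in>UNIV. Poly_Mapping.lookup m i) = d)"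

section \<open>The differentiation action\<close>

text \<open>If \<open>x\<^sub>i\<close> does not occur in the monomial \<open>m\<close>, truncated subtraction gives
  \<open>m - single i 1 = m\<close>, but then the coefficient is \<open>0\<close>.\<close>

definition pdiff :: "'n \<Rightarrow> ('n, 'k::comm_semiring_1) mpoly \<Rightarrow> ('n, 'k) mpoly" where
  "pdiff i F = (\<Sum>m\<in>Poly_Mapping.keys F.
     Poly_Mapping.single (m - Poly_Mapping.single i 1)
       (of_nat (Poly_Mapping.lookup m i) * Poly_Mapping.lookup F m))"

text \<open>The composition of all \<open>(\<partial>/\<partial>x\<^sub>i)^(m\<^sub>i)\<close>, applied to \<open>F\<close>; the fold is independent of the
  order because partial derivatives commute (lemma \<open>pdiff_commute\<close> below).\<close>

definition mono_act :: "('n::finite \<Rightarrow>\<^sub>0 nat) \<Rightarrow> ('n, 'k::comm_semiring_1) mpoly \<Rightarrow> ('n, 'k) mpoly" where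
  "mono_act m F = Finite_Set.fold (\<lambda>i. pdiff i ^^ Poly_Mapping.lookup m i) F UNIV"

definition act :: "('n::finite, 'k::comm_semiring_1) mpoly \<Rightarrow> ('n, 'k) mpoly \<Rightarrow> ('n, 'k) mpoly" where
  "act q F = (\<Sum>m\<in>Poly_Mapping.keys q. Const (Poly_Mapping.lookup q m) * mono_act m F)"

definition Ann :: "('n::finite, 'k::comm_semiring_1) mpoly \<Rightarrow> ('n, 'k) mpoly set" where
  "Ann F = {q. act q F = 0}"

section \<open>The graded algebra \<open>A = Q/Ann F\<close>\<close>

definition Aring :: "('n::finite, 'k::field) mpoly \<Rightarrow> ('n, 'k) mpoly set ring" where
  "Aring F = ring_of_type_algebra Quot Ann F"

definition Acls :: "('n::finite, 'k::field) mpoly \<Rightarrow> ('n, 'k) mpoly \<Rightarrow> ('n, 'k) mpoly set" where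
  "Acls F q = Ann F +>\<^bsub>ring_of_type_algebra\<^esub> q"

definition Agr :: "('n::finite, 'k::field) mpoly \<Rightarrow> nat \<Rightarrow> ('n, 'k) mpoly set set" where
  "Agr F d = Acls F ` {q. homogeneous d q}"

text \<open>The image of \<open>k\<close> in \<open>A\<close>; it is a subfield when \<open>F \<noteq> 0\<close>, and \<open>k\<close>-linear notions in \<open>A\<close> are
  taken over it (theory \<^theory>\<open>HOL-Algebra.Embedded_Algebras\<close>).\<close>

definition Ascalars :: "('n::finite, 'k::field) mpoly \<Rightarrow> ('n, 'k) mpoly set set" where
  "Ascalars F = range (\<lambda>c. Acls F (Const c))"

text \<open>\<open>Bs\<close> lists homogeneous representatives of a \<open>k\<close>-basis of \<open>A\<^sub>d\<close>.\<close>

definition Abasis :: "('n::finite, 'k::field) mpoly \<Rightarrow> nat \<Rightarrow> ('n, 'k) mpoly list \<Rightarrow> bool" where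
  "Abasis F d Bs \<longleftrightarrow>
     (\<forall>b\<in>set Bs. homogeneous d b) \<and>
     ring.independent (Aring F) (Ascalars F) (map (Acls F) Bs) \<and>
     ring.Span (Aring F) (Ascalars F) (map (Acls F) Bs) = Agr F d"

definition strong_Lefschetz_element ::
  "('a, 'b) ring_scheme \<Rightarrow> (nat \<Rightarrow> 'a set) \<Rightarrow> nat \<Rightarrow> 'a \<Rightarrow> bool" where
  "strong_Lefschetz_element A gr D l \<longleftrightarrow>
     l \<in> gr 1 \<and>
     (\<forall>i\<le>D div 2. bij_betw (\<lambda>y. (l [^]\<^bsub>A\<^esub> (D - 2 * i)) \<otimes>\<^bsub>A\<^esub> y) (gr i) (gr (D - i)))"

definition Hess :: "('n::finite, 'k::field) mpoly list \<Rightarrow> ('n, 'k) mpoly \<Rightarrow> ('n, 'k) mpoly" where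
  "Hess Bs F =
     det (mat (length Bs) (length Bs) (\<lambda>(i, j). act (Bs ! i * Bs ! j) F))"

section \<open>The action is a module structure, and \<open>A\<close> is a ring containing \<open>k\<close>\<close>

lemma lookup_pdiff:
  "Poly_Mapping.lookup (pdiff i F) m =
     of_nat (Suc (Poly_Mapping.lookup m i)) * Poly_Mapping.lookup F (m + Poly_Mapping.single i 1)"
proof -
  let ?s = "Poly_Mapping.single i (1::nat)"
  have eq: "Poly_Mapping.lookup (Poly_Mapping.single (n - ?s)
       (of_nat (Poly_Mapping.lookup n i) * Poly_Mapping.lookup F n)) m =
     (if n = m + ?s then of_nat (Suc (Poly_Mapping.lookup m i)) * Poly_Mapping.lookup F (m + ?s) else 0)" for n
  proof (cases "Poly_Mapping.lookup n i = 0")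
    case True
    then have "n \<noteq> m + ?s" by (auto simp: lookup_add)
    with True show ?thesis by simp
  next
    case False
    have "n - ?s + ?s = n"
      using False by (intro poly_mapping_eqI) (auto simp: lookup_add lookup_minus lookup_single when_def)
    then have "n - ?s = m \<longleftrightarrow> n = m + ?s" by auto
    then show ?thesis by (auto simp: lookup_single when_def lookup_add)
  qed
  show ?thesis
    unfolding pdiff_def lookup_sum eq
    by (auto simp: in_keys_iff)
qed

lemma pdiff_add: "pdiff i (F + G) = pdiff i F + pdiff i G"
  by (rule poly_mapping_eqI) (simp add: lookup_pdiff lookup_add algebra_simps)

lemma lookup_Const_mult [simp]:
  "Poly_Mapping.lookup (Const c * F) m = c * Poly_Mapping.lookup F m"
  unfolding Const_def mult_map_scale_conv_mult[symmetric]
  by (simp add: Poly_Mapping.map.rep_eq when_def)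

lemma pdiff_Const_mult: "pdiff i (Const c * F) = Const c * pdiff i F"
  by (rule poly_mapping_eqI) (simp add: lookup_pdiff mult.left_commute)

lemma pdiff_commute: "pdiff i (pdiff j F) = pdiff j (pdiff i F)"
  by (rule poly_mapping_eqI)
     (auto simp: lookup_pdiff lookup_add lookup_single when_def algebra_simps)

lemma pdiff_pow_commute: "(pdiff i ^^ a) ((pdiff j ^^ b) F) = (pdiff j ^^ b) ((pdiff i ^^ a) F)"
proof -
  have 1: "pdiff i ((pdiff j ^^ b) F) = (pdiff j ^^ b) (pdiff i F)" for F
    by (induction b) (auto simp: pdiff_commute[of i j])
  show ?thesis by (induction a) (auto simp: 1)
qed

lemma pdiff_fold_commute:
  "comp_fun_commute (\<lambda>i. pdiff i ^^ Poly_Mapping.lookup m i :: ('n, 'k::comm_semiring_1) mpoly \<Rightarrow> _)"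
  by standard (auto simp: pdiff_pow_commute fun_eq_iff)

lemma pdiff_pow_add: "(pdiff i ^^ a) (F + G) = (pdiff i ^^ a) F + (pdiff i ^^ a) G"
  by (induction a) (auto simp: pdiff_add)

lemma pdiff_pow_Const_mult: "(pdiff i ^^ a) (Const c * F) = Const c * (pdiff i ^^ a) F"
  by (induction a) (auto simp: pdiff_Const_mult)

lemma mono_act_zero [simp]: "mono_act 0 F = F"
proof -
  interpret comp_fun_commute "\<lambda>i. pdiff i ^^ Poly_Mapping.lookup (0 :: 'a \<Rightarrow>\<^sub>0 nat) i
      :: ('a, 'b) mpoly \<Rightarrow> _"
    by (rule pdiff_fold_commute)
  have "Finite_Set.fold (\<lambda>i. pdiff i ^^ Poly_Mapping.lookup (0 :: 'a \<Rightarrow>\<^sub>0 nat) i) F S = F"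
    if "finite S" for S
    using that
  proof (induction S)
    case (insert x S)
    show ?case unfolding fold_insert[OF insert(1,2)] insert(3) by simp
  qed simp
  then show ?thesis by (simp add: mono_act_def)
qed

lemma mono_act_add: "mono_act m (F + G) = mono_act m F + mono_act m G"
proof -
  interpret comp_fun_commute "\<lambda>i. pdiff i ^^ Poly_Mapping.lookup m i :: ('a, 'b) mpoly \<Rightarrow> _"
    by (rule pdiff_fold_commute)
  let ?f = "\<lambda>i. pdiff i ^^ Poly_Mapping.lookup m i"
  have "Finite_Set.fold ?f (F + G) S = Finite_Set.fold ?f F S + Finite_Set.fold ?f G S"
    if "finite S" for S
    using that by (induction S) (simp_all add: pdiff_pow_add)
  then show ?thesis by (simp add: mono_act_def)
qed

lemma mono_act_Const_mult: "mono_act m (Const c * F) = Const c * mono_act m F"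
proof -
  interpret comp_fun_commute "\<lambda>i. pdiff i ^^ Poly_Mapping.lookup m i :: ('a, 'b) mpoly \<Rightarrow> _"
    by (rule pdiff_fold_commute)
  let ?f = "\<lambda>i. pdiff i ^^ Poly_Mapping.lookup m i"
  have "Finite_Set.fold ?f (Const c * F) S = Const c * Finite_Set.fold ?f F S"
    if "finite S" for S
    using that by (induction S) (simp_all add: pdiff_pow_Const_mult)
  then show ?thesis by (simp add: mono_act_def)
qed

lemma mono_act_mono_act: "mono_act (m + m') F = mono_act m (mono_act m' F)"
proof -
  let ?f = "\<lambda>m i. pdiff i ^^ Poly_Mapping.lookup m i :: ('a, 'b) mpoly \<Rightarrow> _"
  interpret a: comp_fun_commute "?f m" by (rule pdiff_fold_commute)
  interpret b: comp_fun_commute "?f m'" by (rule pdiff_fold_commute)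
  interpret c: comp_fun_commute "?f (m + m')" by (rule pdiff_fold_commute)
  have com: "Finite_Set.fold (?f m) ((pdiff i ^^ k) G) S = (pdiff i ^^ k) (Finite_Set.fold (?f m) G S)"
    if "finite S" for S i k G
    using that by (induction S) (simp_all add: pdiff_pow_commute)
  have "Finite_Set.fold (?f (m + m')) F S = Finite_Set.fold (?f m) (Finite_Set.fold (?f m') F S) S"
    if "finite S" for S
    using that
  proof (induction S)
    case (insert x S)
    show ?case
      unfolding a.fold_insert[OF insert(1,2)] b.fold_insert[OF insert(1,2)] c.fold_insert[OF insert(1,2)]
        insert(3) com[OF insert(1)]
      by (simp add: lookup_add funpow_add)
  qed simp
  then show ?thesis by (simp add: mono_act_def)
qed

lemma act_superset:
  assumes "finite S" "Poly_Mapping.keys q \<subseteq> S"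
  shows "act q F = (\<Sum>m\<in>S. Const (Poly_Mapping.lookup q m) * mono_act m F)"
  unfolding act_def
  by (rule sum.mono_neutral_left) (use assms in \<open>auto simp: in_keys_iff Const_def\<close>)

lemma Const_add: "Const (c + d) = Const c + Const d"
  by (simp add: Const_def single_add)

lemma Const_mult: "Const (c * d) = Const c * Const d"
  by (simp add: Const_def mult_single)

lemma act_add_left: "act (p + q) F = act p F + act q F"
proof -
  let ?S = "Poly_Mapping.keys p \<union> Poly_Mapping.keys q"
  have "Poly_Mapping.keys (p + q) \<subseteq> ?S" by (rule Poly_Mapping.keys_add)
  then show ?thesis
    by (simp add: act_superset[of ?S] lookup_add Const_add ring_distribs sum.distrib)
qed

lemma act_add_right: "act q (F + G) = act q F + act q G"
  by (simp add: act_def mono_act_add ring_distribs sum.distrib)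

lemma act_single: "act (Poly_Mapping.single m c) F = Const c * mono_act m F"
  by (subst act_superset[of "{m}"]) auto

lemma act_zero_left [simp]: "act 0 F = 0"
  by (simp add: act_def)

lemma act_sum_left: "act (\<Sum>x\<in>S. g x) F = (\<Sum>x\<in>S. act (g x) F)"
  by (induction S rule: infinite_finite_induct) (simp_all add: act_add_left)

lemma mpoly_sum_single:
  "q = (\<Sum>m\<in>Poly_Mapping.keys q. Poly_Mapping.single m (Poly_Mapping.lookup q m))"
  by (rule poly_mapping_eqI)
     (auto simp: lookup_sum lookup_single when_def in_keys_iff)

lemma act_zero_right [simp]: "act q (0 :: ('n::finite, 'k::comm_ring_1) mpoly) = 0"
  using act_add_right[of q 0 0] by simp

lemma act_sum_right:
  "act q (\<Sum>x\<in>S. g x) = (\<Sum>x\<in>S. act q (g x :: ('n::finite, 'k::comm_ring_1) mpoly))"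
  by (induction S rule: infinite_finite_induct) (simp_all add: act_add_right)

lemma act_mult: "act (p * q) F = act p (act q (F :: ('n::finite, 'k::comm_ring_1) mpoly))"
proof -
  have single: "act (Poly_Mapping.single m c * Poly_Mapping.single m' c') F =
      act (Poly_Mapping.single m c) (act (Poly_Mapping.single m' c') F)" for m c m' c'
    by (simp add: mult_single act_single mono_act_mono_act mono_act_Const_mult Const_mult mult.assoc)
  obtain S g T h where p: "p = (\<Sum>m\<in>S. Poly_Mapping.single m (g m))"
    and q: "q = (\<Sum>m\<in>T. Poly_Mapping.single m (h m))"
    using mpoly_sum_single[of p] mpoly_sum_single[of q] by blast
  show ?thesis
    unfolding p q
    by (simp add: sum_product act_sum_left act_sum_right single) (rule sum.swap)
qed

lemma act_Const: "act (Const c) F = Const c * F"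
  by (simp add: Const_def act_single)

lemma act_one [simp]: "act 1 F = F"
  using act_Const[of 1 F] by (simp add: Const_def)

lemma act_Var: "act (Var i) F = pdiff i F"
proof -
  interpret comp_fun_commute
    "\<lambda>j. pdiff j ^^ Poly_Mapping.lookup (Poly_Mapping.single i 1) j :: ('a, 'b) mpoly \<Rightarrow> _"
    by (rule pdiff_fold_commute)
  have "Finite_Set.fold (\<lambda>j. pdiff j ^^ Poly_Mapping.lookup (Poly_Mapping.single i 1) j) F S =
      (if i \<in> S then pdiff i F else F)" if "finite S" for S
    using that
  proof (induction S)
    case (insert x S)
    show ?case unfolding fold_insert[OF insert(1,2)] insert(3) using insert(2)
      by (auto simp: lookup_single when_def)
  qed simp
  then show ?thesis
    by (simp add: Var_def act_single mono_act_def Const_def)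
qed

lemma module_act: "Modules.module (act :: ('n::finite, 'k::comm_ring_1) mpoly \<Rightarrow> _)"
  by standard (simp_all add: act_add_left act_add_right act_mult)

lemma ideal_Ann: "ideal (Ann F) (ring_of_type_algebra :: ('n::finite, 'k::field) mpoly ring)"
proof (rule idealI)
  interpret m: Modules.module "act :: ('n, 'k) mpoly \<Rightarrow> _" by (rule module_act)
  show "ring (ring_of_type_algebra :: ('n, 'k) mpoly ring)" by (rule ring_from_type_algebra)
  then interpret ring "ring_of_type_algebra :: ('n, 'k) mpoly ring" .
  show "subgroup (Ann F) (add_monoid (ring_of_type_algebra :: ('n, 'k) mpoly ring))"
  proof (rule add.subgroupI)
    show "\<ominus>\<^bsub>ring_of_type_algebra\<^esub> x \<in> Ann F" if "x \<in> Ann F" for x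
    proof -
      have "\<ominus>\<^bsub>ring_of_type_algebra\<^esub> x = - x"
        by (rule minus_equality) (auto simp: ring_of_type_algebra_def)
      then show ?thesis using that by (simp add: Ann_def)
    qed
  qed (auto simp: Ann_def ring_of_type_algebra_def act_add_left intro!: exI[of _ 0])
  show "x \<otimes>\<^bsub>ring_of_type_algebra\<^esub> q \<in> Ann F" "q \<otimes>\<^bsub>ring_of_type_algebra\<^esub> x \<in> Ann F" if "q \<in> Ann F" for q x
    using that act_mult[of x q F] by (simp_all add: Ann_def ring_of_type_algebra_def mult.commute)
qed

lemma cring_Aring: "cring (Aring F)"
  unfolding Aring_def by (rule ideal.quotient_is_cring[OF ideal_Ann cring_from_type_algebra])

lemma Acls_ring_hom: "Acls F \<in> Ring.ring_hom ring_of_type_algebra (Aring F)"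
  using ideal.rcos_ring_hom[OF ideal_Ann[of F]] unfolding Aring_def Acls_def .

lemma subfield_Ascalars:
  fixes F :: "('n::finite, 'k::field) mpoly"
  assumes "F \<noteq> 0"
  shows "subfield (Ascalars F) (Aring F)"
proof -
  let ?k = "ring_of_type_algebra :: 'k ring" and ?Q = "ring_of_type_algebra :: ('n, 'k) mpoly ring"
  interpret k: field ?k by (rule field_from_type_algebra)
  interpret A: cring "Aring F" by (rule cring_Aring)
  interpret I: ideal "Ann F" ?Q by (rule ideal_Ann)
  have "Const \<in> Ring.ring_hom ?k ?Q"
    by (rule ring_hom_memI) (auto simp: ring_of_type_algebra_def Const_mult Const_add, simp add: Const_def)
  then have "Acls F \<circ> Const \<in> Ring.ring_hom ?k (Aring F)"
    by (rule ring_hom_trans) (rule Acls_ring_hom)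
  then interpret h: ring_hom_ring ?k "Aring F" "Acls F \<circ> Const"
    by (intro ring_hom_ringI2 k.ring_axioms A.ring_axioms)
  have "(1 :: ('n, 'k) mpoly) \<notin> Ann F"
    using assms by (simp add: Ann_def)
  then have "Acls F 1 \<noteq> Ann F"
    using I.a_rcos_self[of 1] by (auto simp: Acls_def ring_of_type_algebra_def)
  then have "\<one>\<^bsub>Aring F\<^esub> \<noteq> \<zero>\<^bsub>Aring F\<^esub>"
    by (simp add: Aring_def FactRing_def Acls_def ring_of_type_algebra_def)
  then have "subfield ((Acls F \<circ> Const) ` carrier ?k) (Aring F)"
    by (intro h.img_is_subfield(2) k.carrier_is_subfield)
  then show ?thesis
    by (simp add: Ascalars_def image_image ring_of_type_algebra_def)
qed

end

theory Submission
  imports Defs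
begin

text \<open>
  Let \<open>L = a\<^sub>1 X\<^sub>1 + \<dots> + a\<^sub>n X\<^sub>n\<close>. If \<open>G\<close> is homogeneous of degree \<open>e\<close>, iterating Euler's formula gives
  \<open>L\<^sup>e G = e! G(a)\<close>. Applied to \<open>G = b\<^sub>i b\<^sub>j F\<close>, for a basis \<open>(b\<^sub>i)\<close> of \<open>A\<^sub>d\<close>, this identifies the Hessian
  matrix at \<open>a\<close>, up to the factor \<open>(D - 2d)!\<close>, with the matrix of the bilinear form
  \<open>(y, z) \<mapsto> L\<^sup>e y z F\<close> on \<open>A\<^sub>d\<close>, where \<open>e = D - 2d\<close>. Since the pairing between \<open>A\<^sub>d\<close> and \<open>A\<^sub>D\<^sub>-\<^sub>d\<close> is
  nondegenerate, this matrix is invertible exactly when multiplication by \<open>L\<^sup>e\<close> is a bijection from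
  \<open>A\<^sub>d\<close> to \<open>A\<^sub>D\<^sub>-\<^sub>d\<close>. The condition \<open>F(a) \<noteq> 0\<close> is the case \<open>d = 0\<close> with the basis \<open>1\<close>.
\<close>

section \<open>Evaluation\<close>

text \<open>Lets \<open>F\<close>, \<open>G\<close> and \<open>F + G\<close> be evaluated over one
  common finite set of exponents.\<close>

lemma mpoly_eval_superset:
  assumes "finite S" "Poly_Mapping.keys F \<subseteq> S"
  shows "mpoly_eval a F = (\<Sum>m\<in>S. Poly_Mapping.lookup F m * (\<Prod>i\<in>UNIV. a i ^ Poly_Mapping.lookup m i))"
  unfolding mpoly_eval_def
  by (rule sum.mono_neutral_left) (use assms in \<open>auto simp: in_keys_iff\<close>)

lemma mpoly_eval_zero [simp]: "mpoly_eval a 0 = 0"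
  by (simp add: mpoly_eval_def)

lemma mpoly_eval_add: "mpoly_eval a (F + G) = mpoly_eval a F + mpoly_eval a G"
proof -
  let ?S = "Poly_Mapping.keys F \<union> Poly_Mapping.keys G"
  have "Poly_Mapping.keys (F + G) \<subseteq> ?S" by (rule Poly_Mapping.keys_add)
  then show ?thesis
    by (simp add: mpoly_eval_superset[of ?S] lookup_add ring_distribs sum.distrib)
qed

lemma mpoly_eval_single:
  "mpoly_eval a (Poly_Mapping.single m c) = c * (\<Prod>i\<in>UNIV. a i ^ Poly_Mapping.lookup m i)"
  by (subst mpoly_eval_superset[of "{m}"]) auto

lemma mpoly_eval_sum: "mpoly_eval a (\<Sum>x\<in>S. g x) = (\<Sum>x\<in>S. mpoly_eval a (g x))"
  by (induction S rule: infinite_finite_induct) (simp_all add: mpoly_eval_add)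

lemma mpoly_eval_Const [simp]: "mpoly_eval a (Const c) = c"
  by (simp add: Const_def mpoly_eval_single)

lemma mpoly_eval_mult: "mpoly_eval a (F * G) = mpoly_eval a F * mpoly_eval a G"
proof -
  have single: "mpoly_eval a (Poly_Mapping.single m c * Poly_Mapping.single m' c') =
      mpoly_eval a (Poly_Mapping.single m c) * mpoly_eval a (Poly_Mapping.single m' c')" for m c m' c'
    by (simp add: mult_single mpoly_eval_single lookup_add power_add prod.distrib mult.assoc mult.left_commute)
  obtain S g T h where p: "F = (\<Sum>m\<in>S. Poly_Mapping.single m (g m))"
    and q: "G = (\<Sum>m\<in>T. Poly_Mapping.single m (h m))"
    using mpoly_sum_single[of F] mpoly_sum_single[of G] by blast
  show ?thesis
    unfolding p q by (simp add: sum_product mpoly_eval_sum single)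
qed

lemma comm_ring_hom_mpoly_eval:
  "comm_ring_hom (mpoly_eval a :: ('n::finite, 'k::comm_ring_1) mpoly \<Rightarrow> 'k)"
  by standard (use mpoly_eval_Const[of a 1] in \<open>simp_all add: mpoly_eval_add mpoly_eval_mult Const_def\<close>)

section \<open>Homogeneous polynomials\<close>

abbreviation mdeg :: "('n::finite \<Rightarrow>\<^sub>0 nat) \<Rightarrow> nat" where
  "mdeg m \<equiv> \<Sum>i\<in>UNIV. Poly_Mapping.lookup m i"

lemma homogeneous_iff: "homogeneous d F \<longleftrightarrow> (\<forall>m. Poly_Mapping.lookup F m \<noteq> 0 \<longrightarrow> mdeg m = d)"
  by (auto simp: homogeneous_def in_keys_iff)

lemma homogeneous_0 [simp]: "homogeneous d 0"
  by (simp add: homogeneous_iff)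

lemma homogeneous_add: "homogeneous d p \<Longrightarrow> homogeneous d q \<Longrightarrow> homogeneous d (p + q)"
  by (auto simp: homogeneous_iff lookup_add) (metis add.left_neutral)

lemma homogeneous_diff:
  "homogeneous d p \<Longrightarrow> homogeneous d q \<Longrightarrow> homogeneous d (p - q :: ('n::finite, 'k::ab_group_add) mpoly)"
  by (auto simp: homogeneous_iff lookup_minus) (metis diff_self)

lemma homogeneous_sum: "(\<And>x. x \<in> S \<Longrightarrow> homogeneous d (g x)) \<Longrightarrow> homogeneous d (\<Sum>x\<in>S. g x)"
  by (induction S rule: infinite_finite_induct) (auto intro: homogeneous_add)

lemma homogeneous_mult:
  assumes "homogeneous d p" "homogeneous e q"
  shows "homogeneous (d + e) (p * q)"
  unfolding homogeneous_def
proof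
  fix m assume "m \<in> Poly_Mapping.keys (p * q)"
  then obtain u v where "u \<in> Poly_Mapping.keys p" "v \<in> Poly_Mapping.keys q" "m = u + v"
    using keys_mult[of p q] by blast
  with assms show "mdeg m = d + e"
    by (simp add: homogeneous_def lookup_add sum.distrib)
qed

lemma homogeneous_Const: "homogeneous 0 (Const c)"
  by (auto simp: homogeneous_iff Const_def lookup_single when_def)

lemma homogeneous_Const_mult:
  "homogeneous d p \<Longrightarrow> homogeneous d (Const c * p :: ('n::finite, 'k::comm_semiring_1) mpoly)"
  using homogeneous_mult[OF homogeneous_Const] by fastforce

lemma mdeg_single [simp]: "mdeg (Poly_Mapping.single i k) = k"
  by (simp add: lookup_single when_def)

lemma homogeneous_single: "homogeneous (mdeg m) (Poly_Mapping.single m c)"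
  by (auto simp: homogeneous_iff lookup_single when_def)

lemma homogeneous_Var: "homogeneous 1 (Var i)"
  using homogeneous_single[of "Poly_Mapping.single i 1"] unfolding Var_def mdeg_single .

lemma Const_1 [simp]: "Const 1 = 1"
  by (simp add: Const_def)

lemma homogeneous_1: "homogeneous 0 (1 :: ('n::finite, 'k::comm_semiring_1) mpoly)"
  unfolding Const_1[symmetric] by (rule homogeneous_Const)

lemma homogeneous_power:
  fixes p :: "('n::finite, 'k::comm_semiring_1) mpoly"
  shows "homogeneous d p \<Longrightarrow> homogeneous (n * d) (p ^ n)"
  by (induction n) (simp_all add: homogeneous_1 homogeneous_mult)

text \<open>Only the exponent \<open>0\<close> has degree 0. Pairings between A_d and A_(D-d) land
  in degree 0 and so become scalars.\<close>

lemma homogeneous_0_imp_Const: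
  fixes p :: "('n::finite, 'k::zero) mpoly"
  assumes "homogeneous 0 p"
  shows "p = Const (Poly_Mapping.lookup p 0)"
proof (rule poly_mapping_eqI)
  fix m :: "'n \<Rightarrow>\<^sub>0 nat"
  have "m = 0" if "mdeg m = 0"
    using that by (intro poly_mapping_eqI) simp
  then show "Poly_Mapping.lookup p m = Poly_Mapping.lookup (Const (Poly_Mapping.lookup p 0)) m"
    using assms by (auto simp: homogeneous_iff Const_def lookup_single when_def)
qed

section \<open>Monomial derivatives: degrees and nondegeneracy\<close>

lemma mono_act_single: "mono_act (Poly_Mapping.single i 1) F = pdiff i F"
  using act_Var[of i F] by (simp add: Var_def act_single)

text \<open>The constant is the product of the \<open>(n\<^sub>i + m\<^sub>i)! / n\<^sub>i!\<close>; only its positivity matters.\<close>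

lemma lookup_mono_act:
  "\<exists>c>0. \<forall>G :: ('n::finite, 'k::comm_semiring_1) mpoly.
     Poly_Mapping.lookup (mono_act m G) n = of_nat c * Poly_Mapping.lookup G (n + m)"
proof (induction "mdeg m" arbitrary: m n rule: less_induct)
  case less
  show ?case
  proof (cases "m = 0")
    case True
    then show ?thesis by (intro exI[of _ 1]) simp
  next
    case False
    then obtain i where i: "Poly_Mapping.lookup m i \<noteq> 0"
      by (metis poly_mapping_eqI lookup_zero)
    \<comment> \<open>Split off one derivative: it contributes the factor n_i + 1 and shifts the
      exponent to \<open>n + s\<close>, where the induction hypothesis for \<open>m'\<close>
      applies.\<close>
    define s where "s = Poly_Mapping.single i (1::nat)"
    define m' where "m' = m - s"
    have m: "m = s + m'"
      using i unfolding m'_def s_def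
      by (intro poly_mapping_eqI) (auto simp: lookup_add lookup_minus lookup_single when_def)
    have "mdeg m = 1 + mdeg m'"
      unfolding m s_def by (simp add: lookup_add sum.distrib flip: One_nat_def)
    then obtain c where c: "c > 0"
      "\<And>G :: ('n, 'k) mpoly. Poly_Mapping.lookup (mono_act m' G) (n + s) = of_nat c * Poly_Mapping.lookup G (n + s + m')"
      using less[of m' "n + s"] by auto
    have "Poly_Mapping.lookup (mono_act m G) n =
        of_nat (Suc (Poly_Mapping.lookup n i) * c) * Poly_Mapping.lookup G (n + m)" for G :: "('n, 'k) mpoly"
      unfolding m mono_act_mono_act
      by (simp only: s_def mono_act_single lookup_pdiff of_nat_mult mult.assoc add.assoc c(2)[unfolded s_def])
    with c(1) show ?thesis by (intro exI[of _ "Suc (Poly_Mapping.lookup n i) * c"]) simp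
  qed
qed

text \<open>By \<open>lookup_mono_act\<close>, an exponent \<open>n\<close> of
  \<open>mono_act m F\<close> comes from the exponent \<open>n + m\<close> of \<open>F\<close>, so
  the degree drops by that of \<open>m\<close>.\<close>

lemma homogeneous_act:
  fixes F :: "('n::finite, 'k::comm_ring_1) mpoly"
  assumes p: "homogeneous d p" and F: "homogeneous (d + e) F"
  shows "homogeneous e (act p F)"
  unfolding act_def
proof (rule homogeneous_sum)
  fix m assume m: "m \<in> Poly_Mapping.keys p"
  have "homogeneous e (mono_act m F)"
    unfolding homogeneous_iff
  proof (intro allI impI)
    fix n assume n: "Poly_Mapping.lookup (mono_act m F) n \<noteq> 0"
    obtain c where "Poly_Mapping.lookup (mono_act m F) n = of_nat c * Poly_Mapping.lookup F (n + m)"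
      using lookup_mono_act[where ?'n = 'n and ?'k = 'k, of m n] by blast
    with n have "Poly_Mapping.lookup F (n + m) \<noteq> 0" by auto
    with F have "mdeg (n + m) = d + e" by (auto simp: homogeneous_iff)
    moreover have "mdeg m = d" using p m by (simp add: homogeneous_def)
    ultimately show "mdeg n = e" by (simp add: lookup_add sum.distrib)
  qed
  then show "homogeneous e (Const (Poly_Mapping.lookup p m) * mono_act m F)"
    by (rule homogeneous_Const_mult)
qed

text \<open>Take for \<open>q\<close> a monomial occurring in \<open>G\<close>: applied to
  \<open>G\<close>, it leaves a constant coefficient that is a positive integer times the
  coefficient of that monomial, hence nonzero in characteristic 0.\<close>

lemma homogeneous_nonzero_pairing:
  fixes G :: "('n::finite, 'k::field_char_0) mpoly"
  assumes "homogeneous e G" "G \<noteq> 0"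
  obtains q where "homogeneous e q" "act q G \<noteq> 0"
proof -
  obtain m where m: "Poly_Mapping.lookup G m \<noteq> 0"
    using assms(2) by (metis poly_mapping_eqI lookup_zero)
  obtain c where "c > 0" "Poly_Mapping.lookup (mono_act m G) 0 = of_nat c * Poly_Mapping.lookup G (0 + m)"
    using lookup_mono_act[where ?'n = 'n and ?'k = 'k, of m 0] by blast
  with m have "Poly_Mapping.lookup (mono_act m G) 0 \<noteq> 0" by simp
  then have "act (Poly_Mapping.single m 1) G \<noteq> 0"
    by (metis act_single Const_1 mult_1 lookup_zero)
  moreover have "homogeneous e (Poly_Mapping.single m 1 :: ('n, 'k) mpoly)"
    using homogeneous_single[of m 1] assms(1) m by (auto simp: homogeneous_iff)
  ultimately show ?thesis using that by blast
qed

section \<open>Euler's formula\<close>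

definition linform :: "('n::finite \<Rightarrow> 'k) \<Rightarrow> ('n, 'k::comm_semiring_1) mpoly" where
  "linform a = (\<Sum>i\<in>UNIV. Const (a i) * Var i)"

lemma homogeneous_linform: "homogeneous 1 (linform a)"
  unfolding linform_def by (intro homogeneous_sum homogeneous_Const_mult homogeneous_Var)

text \<open>At the point \<open>a\<close>, the operator \<open>linform a\<close> agrees with the
  Euler operator, the sum of the x_i d/dx_i, which multiplies each monomial by its degree.\<close>

lemma mpoly_eval_act_linform:
  fixes F :: "('n::finite, 'k::comm_ring_1) mpoly"
  assumes "homogeneous d F"
  shows "mpoly_eval a (act (linform a) F) = of_nat d * mpoly_eval a F"
proof -
  let ?x = "\<lambda>m. \<Prod>j\<in>UNIV. a j ^ Poly_Mapping.lookup m j"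
  \<comment> \<open>Multiplying by a_i restores the power lost to d/dx_i. If x_i is absent, both
    sides carry the factor 0, so truncated subtraction does no harm.\<close>
  have monomial: "a i * (of_nat (Poly_Mapping.lookup m i) * c * ?x (m - Poly_Mapping.single i 1)) =
      of_nat (Poly_Mapping.lookup m i) * (c * ?x m)" for i c and m :: "'n \<Rightarrow>\<^sub>0 nat"
  proof (cases "Poly_Mapping.lookup m i = 0")
    case False
    then have "a i * a i ^ (Poly_Mapping.lookup m i - 1) = a i ^ Poly_Mapping.lookup m i"
      by (simp flip: power_Suc)
    moreover have "(\<Prod>j\<in>UNIV - {i}. a j ^ Poly_Mapping.lookup (m - Poly_Mapping.single i 1) j) =
        (\<Prod>j\<in>UNIV - {i}. a j ^ Poly_Mapping.lookup m j)"
      by (rule prod.cong) (auto simp: lookup_minus lookup_single when_def)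
    ultimately have "a i * ?x (m - Poly_Mapping.single i 1) = ?x m"
      by (simp only: prod.remove[OF finite_UNIV UNIV_I, of _ i] lookup_minus lookup_single_eq mult.assoc[symmetric])
    moreover have "a i * (of_nat (Poly_Mapping.lookup m i) * c * ?x (m - Poly_Mapping.single i 1)) =
        of_nat (Poly_Mapping.lookup m i) * (c * (a i * ?x (m - Poly_Mapping.single i 1)))"
      by (simp only: mult_ac)
    ultimately show ?thesis by (simp only:)
  qed simp
  have "mpoly_eval a (act (linform a) F) = (\<Sum>i\<in>UNIV. a i * mpoly_eval a (pdiff i F))"
    by (simp add: linform_def act_sum_left act_mult act_Const act_Var mpoly_eval_sum mpoly_eval_mult)
  also have "\<dots> = (\<Sum>i\<in>UNIV. \<Sum>m\<in>Poly_Mapping.keys F.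
      of_nat (Poly_Mapping.lookup m i) * (Poly_Mapping.lookup F m * ?x m))"
    unfolding pdiff_def mpoly_eval_sum mpoly_eval_single sum_distrib_left monomial ..
  also have "\<dots> = (\<Sum>m\<in>Poly_Mapping.keys F. of_nat (mdeg m) * (Poly_Mapping.lookup F m * ?x m))"
    by (subst sum.swap) (simp add: sum_distrib_right)
  also have "\<dots> = of_nat d * mpoly_eval a F"
    using assms by (simp add: homogeneous_def mpoly_eval_def sum_distrib_left)
  finally show ?thesis .
qed

text \<open>Each application of L lowers the degree by one and multiplies the value at
  \<open>a\<close> by the current degree; these factors accumulate to e!. In degree 0 a polynomial
  is its own value.\<close>

lemma act_linform_power:
  fixes G :: "('n::finite, 'k::field_char_0) mpoly"
  assumes "homogeneous e G"
  shows "act (linform a ^ e) G = Const (fact e * mpoly_eval a G)"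
  using assms
proof (induction e arbitrary: G)
  case 0
  then have "G = Const (Poly_Mapping.lookup G 0)" by (rule homogeneous_0_imp_Const)
  then show ?case by (metis act_one fact_0 mpoly_eval_Const mult_1 power_0)
next
  case (Suc e)
  have "homogeneous e (act (linform a) G)"
    using homogeneous_act[OF homogeneous_linform[of a], of e G] Suc.prems by simp
  \<comment> \<open>\<open>power_Suc2\<close> puts one L next to \<open>G\<close>: Euler's formula
    handles it in degree \<open>Suc e\<close>, the induction hypothesis the remaining power.\<close>
  from Suc.IH[OF this] show ?case
    by (simp only: power_Suc2 act_mult mpoly_eval_act_linform[OF Suc.prems])
       (simp add: mult_ac)
qed

section \<open>Calculation in the quotient\<close>

lemma act_diff_left:
  "act (p - q) F = act p F - act q (F :: ('n::finite, 'k::comm_ring_1) mpoly)"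
  using act_add_left[of "p - q" q F] by simp

lemma act_diff_right:
  "act p (F - G) = act p F - act p (G :: ('n::finite, 'k::comm_ring_1) mpoly)"
  using act_add_right[of p "F - G" G] by simp

lemma act_act_commute:
  "act p (act q F) = act q (act p (F :: ('n::finite, 'k::comm_ring_1) mpoly))"
  by (metis act_mult mult.commute)

text \<open>The kernel of q |-> qF is \<open>Ann F\<close>, so A is isomorphic to the module QF,
  where equalities in A can be checked.\<close>

lemma Acls_eq_iff: "Acls F p = Acls F q \<longleftrightarrow> act p F = act q F"
proof -
  let ?Q = "ring_of_type_algebra :: ('a, 'b) mpoly ring"
  interpret Q: cring ?Q by (rule cring_from_type_algebra)
  have "\<ominus>\<^bsub>?Q\<^esub> q = - q"
    by (rule Q.minus_equality) (auto simp: ring_of_type_algebra_def)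
  then have "p \<ominus>\<^bsub>?Q\<^esub> q = p - q"
    unfolding a_minus_def by (simp add: ring_of_type_algebra_def)
  then show ?thesis
    using Q.quotient_eq_iff_same_a_r_cos[OF ideal_Ann[of F], of p q]
    by (simp add: Acls_def Ann_def act_diff_left) (simp add: ring_of_type_algebra_def)
qed

lemma Acls_closed [simp]: "Acls F p \<in> carrier (Aring F)"
  using ring_hom_closed[OF Acls_ring_hom[of F], of p] by (simp add: ring_of_type_algebra_def)

lemma Acls_mult: "Acls F p \<otimes>\<^bsub>Aring F\<^esub> Acls F q = Acls F (p * q)"
  using ring_hom_mult[OF Acls_ring_hom[of F], of p q] by (simp add: ring_of_type_algebra_def)

lemma Acls_add: "Acls F p \<oplus>\<^bsub>Aring F\<^esub> Acls F q = Acls F (p + q)"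
  using ring_hom_add[OF Acls_ring_hom[of F], of p q] by (simp add: ring_of_type_algebra_def)

lemma Acls_1: "\<one>\<^bsub>Aring F\<^esub> = Acls F 1"
  using ring_hom_one[OF Acls_ring_hom[of F]] by (simp add: ring_of_type_algebra_def)

lemma Acls_0: "\<zero>\<^bsub>Aring F\<^esub> = Acls F 0"
proof -
  interpret A: cring "Aring F" by (rule cring_Aring)
  have "Acls F 0 \<oplus>\<^bsub>Aring F\<^esub> Acls F 0 = Acls F 0" by (simp add: Acls_add)
  then show ?thesis using A.add.r_cancel_one[of "Acls F 0" "Acls F 0"] by simp
qed

lemma Acls_power: "Acls F p [^]\<^bsub>Aring F\<^esub> (n::nat) = Acls F (p ^ n)"
proof -
  interpret A: cring "Aring F" by (rule cring_Aring)
  show ?thesis by (induction n) (simp_all add: Acls_1 Acls_mult mult.commute)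
qed

text \<open>Translates the ring library's linear combinations over \<open>Ascalars F\<close> into
  explicit polynomials, the form to which \<open>Acls_eq_iff\<close> applies.\<close>

lemma combine_Acls:
  assumes "length cs = length Bs"
  shows "ring.combine (Aring F) (map (\<lambda>c. Acls F (Const c)) cs) (map (Acls F) Bs) =
    Acls F (\<Sum>i<length Bs. Const (cs ! i) * Bs ! i)"
proof -
  interpret A: cring "Aring F" by (rule cring_Aring)
  show ?thesis
    using assms
    by (induction cs Bs rule: list_induct2)
       (simp_all add: Acls_0 Acls_mult Acls_add sum.lessThan_Suc_shift del: sum.lessThan_Suc)
qed

section \<open>Bases of the graded pieces\<close>

definition lincomb :: "('n, 'k) mpoly list \<Rightarrow> (nat \<Rightarrow> 'k) \<Rightarrow> ('n, 'k::comm_semiring_1) mpoly" where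
  "lincomb Bs c = (\<Sum>i<length Bs. Const (c i) * Bs ! i)"

text \<open>\<open>Abasis\<close> transported along [q] |-> qF, with coefficients in k itself rather
  than in its image \<open>Ascalars F\<close>.\<close>

definition graded_basis :: "('n::finite, 'k::field) mpoly \<Rightarrow> nat \<Rightarrow> ('n, 'k) mpoly list \<Rightarrow> bool" where
  "graded_basis F d Bs \<longleftrightarrow>
     (\<forall>b\<in>set Bs. homogeneous d b) \<and>
     (\<forall>c. act (lincomb Bs c) F = 0 \<longrightarrow> (\<forall>i<length Bs. c i = 0)) \<and>
     (\<forall>y. homogeneous d y \<longrightarrow> (\<exists>c. act y F = act (lincomb Bs c) F))"

lemma homogeneous_lincomb: "graded_basis F d Bs \<Longrightarrow> homogeneous d (lincomb Bs c)"
  unfolding lincomb_def graded_basis_def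
  by (intro homogeneous_sum homogeneous_Const_mult) auto

lemma act_lincomb:
  "act (lincomb Bs c) F = (\<Sum>i<length Bs. Const (c i) * act (Bs ! i) (F :: ('n::finite, 'k::comm_ring_1) mpoly))"
  by (simp add: lincomb_def act_sum_left act_mult act_Const)

lemma Abasis_imp_graded_basis:
  fixes F :: "('n::finite, 'k::field) mpoly"
  assumes "F \<noteq> 0" "Abasis F d Bs"
  shows "graded_basis F d Bs"
  unfolding graded_basis_def
proof (intro conjI allI impI)
  interpret A: cring "Aring F" by (rule cring_Aring)
  note K = subfield_Ascalars[OF assms(1)]
  show "\<forall>b\<in>set Bs. homogeneous d b" using assms(2) by (simp add: Abasis_def)
  have ind: "A.independent (Ascalars F) (map (Acls F) Bs)"
    and span: "A.Span (Ascalars F) (map (Acls F) Bs) = Agr F d"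
    using assms(2) by (simp_all add: Abasis_def)
  have comb: "A.combine (map (\<lambda>i. Acls F (Const (c i))) [0..<length Bs]) (map (Acls F) Bs) = Acls F (lincomb Bs c)"
    for c
    using combine_Acls[of "map c [0..<length Bs]" Bs F] by (simp add: lincomb_def comp_def)
  show "c i = 0" if c: "act (lincomb Bs c) F = 0" and i: "i < length Bs" for c i
  proof -
    let ?Ks = "map (\<lambda>i. Acls F (Const (c i))) [0..<length Bs]"
    have "A.combine ?Ks (map (Acls F) Bs) = \<zero>\<^bsub>Aring F\<^esub>"
      unfolding comb Acls_0 Acls_eq_iff using c by simp
    moreover have "set ?Ks \<subseteq> Ascalars F" by (auto simp: Ascalars_def)
    ultimately have "set (take (length (map (Acls F) Bs)) ?Ks) \<subseteq> {\<zero>\<^bsub>Aring F\<^esub>}"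
      using A.independent_imp_trivial_combine[OF K ind] by blast
    \<comment> \<open>The scalar c_i vanishes in A, hence c_i F = 0; since F \<noteq> 0 over a
      field, c_i = 0.\<close>
    with i have "Acls F (Const (c i)) = Acls F 0" by (simp add: Acls_0 image_subset_iff)
    then have "Const (c i) * F = 0" by (simp add: Acls_eq_iff act_Const)
    with assms(1) show "c i = 0"
      by (metis lookup_Const_mult lookup_zero mult_eq_0_iff poly_mapping_eqI)
  qed
  show "\<exists>c. act y F = act (lincomb Bs c) F" if "homogeneous d y" for y
  proof -
    have "Acls F y \<in> A.Span (Ascalars F) (map (Acls F) Bs)"
      unfolding span using that by (auto simp: Agr_def)
    then obtain Ks where Ks: "set Ks \<subseteq> Ascalars F" "length Ks = length Bs"
      "Acls F y = A.combine Ks (map (Acls F) Bs)"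
      using A.Span_mem_iff_length_version[OF K, of "map (Acls F) Bs" "Acls F y"]
      by (auto simp: image_subset_iff simp del: A.Span.simps)
    then have "\<forall>i<length Bs. \<exists>c. Ks ! i = Acls F (Const c)"
      by (metis (no_types, lifting) Ascalars_def image_iff nth_mem subsetD)
    then obtain c where "\<forall>i<length Bs. Ks ! i = Acls F (Const (c i))" by metis
    then have "Ks = map (\<lambda>i. Acls F (Const (c i))) [0..<length Bs]"
      using Ks(2) by (intro nth_equalityI) auto
    then show ?thesis using Ks(3) comb[of c] Acls_eq_iff by metis
  qed
qed

text \<open>Elements of degree 0 act as scalars, so A_0 = k. This lets F be treated as its own
  Hessian in degree 0.\<close>

lemma graded_basis_0:
  fixes F :: "('n::finite, 'k::field) mpoly"
  assumes "F \<noteq> 0"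
  shows "graded_basis F 0 [1]"
  unfolding graded_basis_def
proof (intro conjI allI impI)
  show "c i = 0" if "act (lincomb [1] c) F = 0" "i < length [1]" for c :: "nat \<Rightarrow> 'k" and i
  proof -
    have "Const (c 0) * F = 0" using that(1) by (simp add: act_lincomb)
    with assms have "c 0 = 0"
      by (metis lookup_Const_mult lookup_zero mult_eq_0_iff poly_mapping_eqI)
    with that(2) show ?thesis by simp
  qed
  show "\<exists>c. act y F = act (lincomb [1] c) F" if "homogeneous 0 y" for y
  proof
    have "act y F = Const (Poly_Mapping.lookup y 0) * F"
      using homogeneous_0_imp_Const[OF that] act_Const by metis
    then show "act y F = act (lincomb [1] (\<lambda>_. Poly_Mapping.lookup y 0)) F"
      by (simp add: act_lincomb)
  qed
qed (simp add: homogeneous_1)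

section \<open>The Hessian as the matrix of a bilinear form\<close>

text \<open>Gorenstein duality: \<open>A\<^sub>D\<^sub>-\<^sub>d\<close> pairs perfectly with \<open>A\<^sub>d\<close>, so it suffices to test against a basis.\<close>

lemma act_eq_0_if_pairing_0:
  fixes F :: "('n::finite, 'k::field_char_0) mpoly"
  assumes F: "homogeneous D F" and "d \<le> D" and B: "graded_basis F d Bs"
    and w: "homogeneous (D - d) w" and pair: "\<And>i. i < length Bs \<Longrightarrow> act (Bs ! i) (act w F) = 0"
  shows "act w F = 0"
proof (rule ccontr)
  assume "act w F \<noteq> 0"
  moreover have "homogeneous d (act w F)"
    using homogeneous_act[OF w] F \<open>d \<le> D\<close> by simp
  ultimately obtain q where q: "homogeneous d q" "act q (act w F) \<noteq> 0"
    using homogeneous_nonzero_pairing by blast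
  \<comment> \<open>Only qF matters in q(wF) = w(qF), so \<open>q\<close> may be replaced by a
    combination of the basis.\<close>
  then obtain c where "act q F = act (lincomb Bs c) F" using B unfolding graded_basis_def by blast
  then have "act q (act w F) = act (lincomb Bs c) (act w F)" by (metis act_act_commute)
  also have "\<dots> = 0" by (simp add: act_lincomb pair)
  finally show False using q(2) by simp
qed

definition hess_mat :: "('n::finite, 'k::field) mpoly list \<Rightarrow> ('n, 'k) mpoly \<Rightarrow> ('n \<Rightarrow> 'k) \<Rightarrow> 'k mat" where
  "hess_mat Bs F a = mat (length Bs) (length Bs) (\<lambda>(i, j). mpoly_eval a (act (Bs ! i * Bs ! j) F))"

lemma hess_mat_carrier [simp]: "hess_mat Bs F a \<in> carrier_mat (length Bs) (length Bs)"
  by (simp add: hess_mat_def)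

text \<open>Evaluation is a ring homomorphism and so commutes with determinants; nonvanishing of the
  Hessian at \<open>a\<close> becomes invertibility of a matrix over k.\<close>

lemma mpoly_eval_Hess: "mpoly_eval a (Hess Bs F) = det (hess_mat Bs F a)"
proof -
  interpret comm_ring_hom "mpoly_eval a" by (rule comm_ring_hom_mpoly_eval)
  show ?thesis
    unfolding Hess_def hom_det[symmetric] hess_mat_def
    by (rule arg_cong[of _ _ det]) (rule eq_matI, auto)
qed

text \<open>By Euler's formula, \<open>hess_mat\<close> is up to the factor \<open>(D - 2d)!\<close> the matrix of the bilinear form
  \<open>(y, z) \<mapsto> L\<^sup>D\<^sup>-\<^sup>2\<^sup>d y z F\<close> on \<open>A\<^sub>d\<close>.\<close>

lemma act_linform_power_lincomb:
  fixes F :: "('n::finite, 'k::field_char_0) mpoly"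
  assumes F: "homogeneous D F" and "2 * d \<le> D" and B: "graded_basis F d Bs" and i: "i < length Bs"
  shows "act (Bs ! i) (act (linform a ^ (D - 2 * d) * lincomb Bs c) F) =
    Const (fact (D - 2 * d) * (hess_mat Bs F a *\<^sub>v vec (length Bs) c) $ i)"
proof -
  let ?e = "D - 2 * d" and ?y = "lincomb Bs c"
  have "homogeneous d (Bs ! i)" using B i by (simp add: graded_basis_def)
  \<comment> \<open>The polynomial b_i y F has degree D - 2d, exactly the exponent of L, as the
    iterated Euler formula requires.\<close>
  then have "homogeneous (d + d) (Bs ! i * ?y)"
    using homogeneous_lincomb[OF B] by (rule homogeneous_mult)
  then have hom: "homogeneous ?e (act (Bs ! i * ?y) F)"
    using homogeneous_act[of "d + d" _ ?e F] F \<open>2 * d \<le> D\<close> by simp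
  have "act (Bs ! i) (act (linform a ^ ?e * ?y) F) = act (linform a ^ ?e) (act (Bs ! i * ?y) F)"
    by (simp add: act_mult[symmetric] mult.left_commute)
  also have "\<dots> = Const (fact ?e * mpoly_eval a (act (Bs ! i * ?y) F))"
    by (rule act_linform_power[OF hom])
  also have "mpoly_eval a (act (Bs ! i * ?y) F) = (hess_mat Bs F a *\<^sub>v vec (length Bs) c) $ i"
  proof -
    have "Bs ! i * ?y = (\<Sum>j<length Bs. Const (c j) * (Bs ! i * Bs ! j))"
      by (simp only: lincomb_def sum_distrib_left mult.left_commute)
    then have "mpoly_eval a (act (Bs ! i * ?y) F) =
        (\<Sum>j<length Bs. c j * mpoly_eval a (act (Bs ! i * Bs ! j) F))"
      by (simp only: act_sum_left act_mult[of "Const _"] act_Const mpoly_eval_sum mpoly_eval_mult mpoly_eval_Const)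
    also have "\<dots> = (hess_mat Bs F a *\<^sub>v vec (length Bs) c) $ i"
      using i by (simp add: hess_mat_def scalar_prod_def atLeast0LessThan mult.commute)
    finally show ?thesis .
  qed
  finally show ?thesis .
qed

section \<open>Injectivity and surjectivity of multiplication by L^e, e = D - 2d\<close>

lemma homogeneous_linform_power_mult:
  assumes d: "2 * d \<le> D" and y: "homogeneous d y"
  shows "homogeneous (D - d) (linform a ^ (D - 2 * d) * y)"
proof -
  have "homogeneous ((D - 2 * d) * 1 + d) (linform a ^ (D - 2 * d) * y)"
    by (intro homogeneous_mult homogeneous_power homogeneous_linform y)
  also have "(D - 2 * d) * 1 + d = D - d" using d by simp
  finally show ?thesis .
qed

text \<open>A nonzero kernel vector of the matrix gives y in A_d, nonzero by independence, with L^e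
  y orthogonal to A_d; duality then forces L^e y = 0, against injectivity.\<close>

lemma inj_imp_det_hess_mat:
  fixes F :: "('n::finite, 'k::field_char_0) mpoly"
  assumes F: "homogeneous D F" and d: "2 * d \<le> D" and B: "graded_basis F d Bs"
    and inj: "\<And>y. homogeneous d y \<Longrightarrow> act (linform a ^ (D - 2 * d) * y) F = 0 \<Longrightarrow> act y F = 0"
  shows "det (hess_mat Bs F a) \<noteq> 0"
proof
  let ?N = "length Bs" and ?L = "linform a ^ (D - 2 * d)"
  assume "det (hess_mat Bs F a) = 0"
  then obtain v where v: "v \<in> carrier_vec ?N" "v \<noteq> 0\<^sub>v ?N" "hess_mat Bs F a *\<^sub>v v = 0\<^sub>v ?N"
    using det_0_iff_vec_prod_zero[OF hess_mat_carrier] by blast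
  define c where "c = (\<lambda>i. v $ i)"
  have vc: "vec ?N c = v" using v(1) by (intro eq_vecI) (auto simp: c_def)
  have hom: "homogeneous (D - d) (?L * lincomb Bs c)"
    by (rule homogeneous_linform_power_mult[OF d homogeneous_lincomb[OF B]])
  have "act (?L * lincomb Bs c) F = 0"
  proof (rule act_eq_0_if_pairing_0[OF F _ B hom])
    show "act (Bs ! i) (act (?L * lincomb Bs c) F) = 0" if "i < ?N" for i
      using act_linform_power_lincomb[OF F d B that, of a c] that by (simp add: vc v(3) Const_def)
  qed (use d in simp)
  then have "act (lincomb Bs c) F = 0" by (rule inj[OF homogeneous_lincomb[OF B]])
  then have "\<forall>i<?N. c i = 0" using B by (simp add: graded_basis_def)
  then have "v = 0\<^sub>v ?N" using v(1) by (intro eq_vecI) (auto simp: c_def)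
  with v(2) show False by simp
qed

text \<open>If L^e y F = 0, every pairing with the basis vanishes; since e! is nonzero, the
  coordinates of y form a kernel vector of an invertible matrix.\<close>

lemma det_hess_mat_imp_inj:
  fixes F :: "('n::finite, 'k::field_char_0) mpoly"
  assumes F: "homogeneous D F" and d: "2 * d \<le> D" and B: "graded_basis F d Bs"
    and det: "det (hess_mat Bs F a) \<noteq> 0"
    and y: "homogeneous d y" "act (linform a ^ (D - 2 * d) * y) F = 0"
  shows "act y F = 0"
proof -
  let ?N = "length Bs" and ?L = "linform a ^ (D - 2 * d)"
  obtain c where c: "act y F = act (lincomb Bs c) F" using B y(1) unfolding graded_basis_def by blast
  then have "act (?L * lincomb Bs c) F = 0" using y(2) by (simp add: act_mult)
  then have "(hess_mat Bs F a *\<^sub>v vec ?N c) $ i = 0" if "i < ?N" for i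
    using act_linform_power_lincomb[OF F d B that, of a c] mpoly_eval_Const[of a]
    by (metis act_zero_right fact_nonzero mpoly_eval_zero mult_eq_0_iff)
  then have "hess_mat Bs F a *\<^sub>v vec ?N c = 0\<^sub>v ?N"
    by (intro eq_vecI) (auto simp: hess_mat_def)
  then have "vec ?N c = 0\<^sub>v ?N"
    using det det_0_iff_vec_prod_zero[OF hess_mat_carrier] by (metis vec_carrier)
  then have "\<forall>i<?N. c i = 0" by (metis index_vec index_zero_vec(1))
  then show ?thesis by (simp add: c act_lincomb Const_def)
qed

lemma det_nonzero_imp_solvable:
  fixes A :: "'a::field mat"
  assumes A: "A \<in> carrier_mat n n" and "det A \<noteq> 0" and v: "v \<in> carrier_vec n"
  obtains x where "x \<in> carrier_vec n" "A *\<^sub>v x = v"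
proof -
  \<comment> \<open>The inverse is read off from the unit group of the matrix ring;
    \<open>()\<close> fills the record extension of that ring.\<close>
  obtain B where B: "B \<in> carrier_mat n n" "A * B = 1\<^sub>m n"
    using det_non_zero_imp_unit[OF A \<open>det A \<noteq> 0\<close>, of "()"]
    by (auto simp: Units_def ring_mat_def)
  show ?thesis
  proof
    show "B *\<^sub>v v \<in> carrier_vec n" using B(1) v by simp
    show "A *\<^sub>v (B *\<^sub>v v) = v"
      using B v A by (metis assoc_mult_mat_vec one_mult_mat_vec)
  qed
qed

text \<open>Solve a linear system for y such that L^e y and z have the same pairings with the basis;
  duality makes them equal in A.\<close>

lemma det_hess_mat_imp_surj:
  fixes F :: "('n::finite, 'k::field_char_0) mpoly"
  assumes F: "homogeneous D F" and d: "2 * d \<le> D" and B: "graded_basis F d Bs"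
    and det: "det (hess_mat Bs F a) \<noteq> 0" and z: "homogeneous (D - d) z"
  obtains y where "homogeneous d y" "act (linform a ^ (D - 2 * d) * y) F = act z F"
proof -
  let ?N = "length Bs" and ?L = "linform a ^ (D - 2 * d)" and ?e = "D - 2 * d"
  \<comment> \<open>The polynomial b_i z F has degree 0, so its coefficient at exponent
    \<open>0\<close> is the pairing of b_i with z.\<close>
  define r where "r i = Poly_Mapping.lookup (act (Bs ! i) (act z F)) 0" for i
  have r: "act (Bs ! i) (act z F) = Const (r i)" if "i < ?N" for i
  proof -
    have "homogeneous d (act z F)" using homogeneous_act[OF z] F d by simp
    moreover have "homogeneous d (Bs ! i)" using B that by (simp add: graded_basis_def)
    ultimately have "homogeneous 0 (act (Bs ! i) (act z F))" by (simp add: homogeneous_act)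
    then show ?thesis unfolding r_def by (rule homogeneous_0_imp_Const)
  qed
  \<comment> \<open>Division by e! offsets the factor in
    \<open>act_linform_power_lincomb\<close>.\<close>
  obtain x where x: "x \<in> carrier_vec ?N" "hess_mat Bs F a *\<^sub>v x = vec ?N (\<lambda>i. r i / fact ?e)"
    using det_nonzero_imp_solvable[OF hess_mat_carrier det vec_carrier] by blast
  define c where "c = (\<lambda>i. x $ i)"
  have xc: "vec ?N c = x" using x(1) by (intro eq_vecI) (auto simp: c_def)
  have hom: "homogeneous (D - d) (?L * lincomb Bs c)"
    by (rule homogeneous_linform_power_mult[OF d homogeneous_lincomb[OF B]])
  have "act (?L * lincomb Bs c - z) F = 0"
  proof (rule act_eq_0_if_pairing_0[OF F _ B homogeneous_diff[OF hom z]])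
    show "act (Bs ! i) (act (?L * lincomb Bs c - z) F) = 0" if "i < ?N" for i
    proof -
      have "act (Bs ! i) (act (?L * lincomb Bs c - z) F) =
          act (Bs ! i) (act (?L * lincomb Bs c) F) - act (Bs ! i) (act z F)"
        by (simp only: act_diff_left act_diff_right)
      then show ?thesis
        using act_linform_power_lincomb[OF F d B that, of a c] that r[OF that] by (simp add: xc x(2))
    qed
  qed (use d in simp)
  then have "act (?L * lincomb Bs c) F = act z F" by (simp add: act_diff_left)
  with homogeneous_lincomb[OF B] show ?thesis by (rule that)
qed

text \<open>Injectivity alone forces a nonzero determinant, which in turn yields both injectivity
  and surjectivity.\<close>

lemma bij_betw_mult_linform_power_iff:
  fixes F :: "('n::finite, 'k::field_char_0) mpoly"
  assumes F: "homogeneous D F" and d: "2 * d \<le> D" and B: "graded_basis F d Bs"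
  shows "bij_betw (\<lambda>y. (Acls F (linform a) [^]\<^bsub>Aring F\<^esub> (D - 2 * d)) \<otimes>\<^bsub>Aring F\<^esub> y) (Agr F d) (Agr F (D - d))
    \<longleftrightarrow> mpoly_eval a (Hess Bs F) \<noteq> 0"
    (is "bij_betw ?f _ _ \<longleftrightarrow> _")
proof -
  let ?L = "linform a ^ (D - 2 * d)"
  have f: "?f (Acls F y) = Acls F (?L * y)" for y by (simp add: Acls_power Acls_mult)
  have hom: "homogeneous (D - d) (?L * y)" if "homogeneous d y" for y
    by (rule homogeneous_linform_power_mult[OF d that])
  show ?thesis unfolding mpoly_eval_Hess
  proof
    assume "bij_betw ?f (Agr F d) (Agr F (D - d))"
    then have inj: "inj_on ?f (Agr F d)" by (rule bij_betw_imp_inj_on)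
    show "det (hess_mat Bs F a) \<noteq> 0"
    proof (rule inj_imp_det_hess_mat[OF F d B])
      fix y assume y: "homogeneous d y" "act (?L * y) F = 0"
      then have "?f (Acls F y) = ?f (Acls F 0)" by (simp add: f Acls_eq_iff)
      moreover have "Acls F y \<in> Agr F d" "Acls F 0 \<in> Agr F d"
        using y(1) homogeneous_0[of d] by (auto simp: Agr_def)
      ultimately have "Acls F y = Acls F 0" using inj by (meson inj_onD)
      then show "act y F = 0" by (simp add: Acls_eq_iff)
    qed
  next
    assume det: "det (hess_mat Bs F a) \<noteq> 0"
    show "bij_betw ?f (Agr F d) (Agr F (D - d))"
      unfolding bij_betw_def
    proof
      show "inj_on ?f (Agr F d)"
      proof (rule inj_onI)
        fix u v assume "u \<in> Agr F d" "v \<in> Agr F d" and eq: "?f u = ?f v"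
        then obtain p q where p: "homogeneous d p" "u = Acls F p" and q: "homogeneous d q" "v = Acls F q"
          by (auto simp: Agr_def)
        have "act (?L * (p - q)) F = 0"
          using eq by (simp add: p(2) q(2) f Acls_eq_iff right_diff_distrib act_diff_left)
        then have "act (p - q) F = 0"
          using det_hess_mat_imp_inj[OF F d B det homogeneous_diff[OF p(1) q(1)]] by blast
        then show "u = v" by (simp add: p(2) q(2) Acls_eq_iff act_diff_left)
      qed
      show "?f ` Agr F d = Agr F (D - d)"
      proof
        show "?f ` Agr F d \<subseteq> Agr F (D - d)" using hom by (auto simp: Agr_def f)
        show "Agr F (D - d) \<subseteq> ?f ` Agr F d"
        proof
          fix w assume "w \<in> Agr F (D - d)"
          then obtain z where z: "homogeneous (D - d) z" "w = Acls F z" by (auto simp: Agr_def)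
          obtain y where "homogeneous d y" "act (?L * y) F = act z F"
            using det_hess_mat_imp_surj[OF F d B det z(1)] .
          then have "w = ?f (Acls F y)" "Acls F y \<in> Agr F d"
            by (simp_all add: z(2) f Acls_eq_iff Agr_def)
          then show "w \<in> ?f ` Agr F d" by blast
        qed
      qed
    qed
  qed
qed

section \<open>Assembling the conditions over all degrees\<close>

theorem theorem3p1:
  fixes F :: "('n::finite, 'k::field_char_0) mpoly"
    and D :: nat
    and B :: "nat \<Rightarrow> ('n, 'k) mpoly list"
    and a :: "'n \<Rightarrow> 'k"
  assumes "D \<ge> 1"
    and "homogeneous D F"
    and "F \<noteq> 0"
    and "\<And>d. 1 \<le> d \<Longrightarrow> d \<le> D div 2 \<Longrightarrow> Abasis F d (B d)"
  shows "strong_Lefschetz_element (Aring F) (Agr F) D (Acls F (\<Sum>i\<in>UNIV. Const (a i) * Var i))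
     \<longleftrightarrow> mpoly_eval a F \<noteq> 0 \<and> (\<forall>d. 1 \<le> d \<and> d \<le> D div 2 \<longrightarrow> mpoly_eval a (Hess (B d) F) \<noteq> 0)"
proof -
  let ?P = "\<lambda>d. bij_betw (\<lambda>y. (Acls F (linform a) [^]\<^bsub>Aring F\<^esub> (D - 2 * d)) \<otimes>\<^bsub>Aring F\<^esub> y) (Agr F d) (Agr F (D - d))"
  have "Acls F (linform a) \<in> Agr F 1"
    using homogeneous_linform by (auto simp: Agr_def)
  then have "strong_Lefschetz_element (Aring F) (Agr F) D (Acls F (linform a)) \<longleftrightarrow> (\<forall>d\<le>D div 2. ?P d)"
    by (simp add: strong_Lefschetz_element_def)
  \<comment> \<open>Bases are given only for d \<ge> 1, so d = 0 is split off and handled with the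
    basis \<open>[1]\<close>.\<close>
  also have "\<dots> \<longleftrightarrow> ?P 0 \<and> (\<forall>d. 1 \<le> d \<and> d \<le> D div 2 \<longrightarrow> ?P d)"
    by (metis One_nat_def Suc_leI neq0_conv zero_le)
  also have "?P 0 \<longleftrightarrow> mpoly_eval a F \<noteq> 0"
  proof -
    \<comment> \<open>For this basis the Hessian matrix is 1 by 1 with entry F.\<close>
    have "Hess [1] F = F" unfolding Hess_def by (subst det_single) auto
    then show ?thesis
      using bij_betw_mult_linform_power_iff[OF assms(2) _ graded_basis_0[OF assms(3)], of a] by simp
  qed
  also have "(\<forall>d. 1 \<le> d \<and> d \<le> D div 2 \<longrightarrow> ?P d) \<longleftrightarrow>
      (\<forall>d. 1 \<le> d \<and> d \<le> D div 2 \<longrightarrow> mpoly_eval a (Hess (B d) F) \<noteq> 0)"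
  proof -
    have "?P d \<longleftrightarrow> mpoly_eval a (Hess (B d) F) \<noteq> 0" if "1 \<le> d" "d \<le> D div 2" for d
      by (rule bij_betw_mult_linform_power_iff[OF assms(2) _ Abasis_imp_graded_basis[OF assms(3) assms(4)[OF that]]])
         (use that in simp)
    then show ?thesis by blast
  qed
  finally show ?thesis unfolding linform_def .
qed

end
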